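(* There exists a universal constant $K>0$ such that the following holds. For every integer $n_0\ge 1$, every probability measure $\mu$ on $\mathbb{R}$ (not assumed to be supported in $[-1,1]$) for which $\int_{\mathbb{R}} |x|^{n_0}\,d\mu(x)<\infty$, and every $x_0\in\mathbb{R}$, $$\big|\mu[x_0,+\infty)-\sigma_1[x_0,+\infty)\big|\le K\left\{\frac{1}{n_0}+\sum_{n=1}^{n_0}\frac1n\left|\int_{\mathbb{R}}T_n(x)\,d\mu(x)\right|\right\}.$$
   Context: $\sigma_1$ is the probability measure on $\mathbb{R}$ (arcsine law on $[-1,1]$) given by $d\sigma_1(x)=\frac1\pi(1-x^2)_+^{-1/2}\,dx$, i.e. with density $\frac{1}{\pi\sqrt{1-x^2}}$ on $(-1,1)$ and $0$ elsewhere. $T_n$ is the Chebyshev polynomial of the first kind, defined by $T_n(\cos\theta)=\cos n\theta$. *)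

theory Defs
  imports "HOL-Probability.Probability" "HOL-Computational_Algebra.Polynomial"
begin

definition cheb_T :: "nat \<Rightarrow> real poly" where
  "cheb_T n = (THE p. \<forall>\<theta>. poly p (cos \<theta>) = cos (real n * \<theta>))"

lemma cheb_T_ex1: "\<exists>!p :: real poly. \<forall>\<theta>. poly p (cos \<theta>) = cos (real n * \<theta>)"
proof (rule ex_ex1I)
  have "(\<exists>p :: real poly. \<forall>\<theta>. poly p (cos \<theta>) = cos (real n * \<theta>)) \<and>
        (\<exists>p :: real poly. \<forall>\<theta>. poly p (cos \<theta>) = cos (real (Suc n) * \<theta>))"
  proof (induction n)
    case 0
    have "\<forall>\<theta>. poly 1 (cos \<theta>) = cos (real 0 * \<theta>)" by simp
    moreover have "\<forall>\<theta>. poly [:0, 1:] (cos \<theta>) = cos (real (Suc 0) * \<theta>)" by simp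
    ultimately show ?case by blast
  next
    case (Suc n)
    then obtain p q :: "real poly"
      where p: "\<forall>\<theta>. poly p (cos \<theta>) = cos (real n * \<theta>)"
        and q: "\<forall>\<theta>. poly q (cos \<theta>) = cos (real (Suc n) * \<theta>)"
      by blast
    have "poly ([:0, 2:] * q - p) (cos \<theta>) = cos (real (Suc (Suc n)) * \<theta>)" for \<theta>
    proof -
      have "cos (real (Suc n) * \<theta> + \<theta>) + cos (real (Suc n) * \<theta> - \<theta>)
              = 2 * cos \<theta> * cos (real (Suc n) * \<theta>)"
        by (simp only: cos_add cos_diff) simp
      moreover have "real (Suc n) * \<theta> + \<theta> = real (Suc (Suc n)) * \<theta>"
        "real (Suc n) * \<theta> - \<theta> = real n * \<theta>"
        by (simp_all add: algebra_simps)
      ultimately have "cos (real (Suc (Suc n)) * \<theta>) =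
          2 * cos \<theta> * cos (real (Suc n) * \<theta>) - cos (real n * \<theta>)"
        by simp
      moreover have "poly ([:0, 2:] * q - p) (cos \<theta>) =
          2 * cos \<theta> * poly q (cos \<theta>) - poly p (cos \<theta>)"
        by (simp add: algebra_simps)
      ultimately show ?thesis using p q by simp
    qed
    with q show ?case by blast
  qed
  then show "\<exists>p :: real poly. \<forall>\<theta>. poly p (cos \<theta>) = cos (real n * \<theta>)" by blast
next
  fix p q :: "real poly"
  assume p: "\<forall>\<theta>. poly p (cos \<theta>) = cos (real n * \<theta>)"
    and q: "\<forall>\<theta>. poly q (cos \<theta>) = cos (real n * \<theta>)"
  have "{-1..1} \<subseteq> {x. poly (p - q) x = 0}"
  proof
    fix x :: real assume "x \<in> {-1..1}"
    then have "cos (arccos x) = x" by (simp add: cos_arccos)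
    with p q have "poly p x = poly q x" by metis
    then show "x \<in> {x. poly (p - q) x = 0}" by simp
  qed
  moreover have "infinite {-1..1::real}" by (simp add: infinite_Icc)
  ultimately have "infinite {x. poly (p - q) x = 0}" using finite_subset by blast
  then show "p = q" using poly_roots_finite[of "p - q"] by auto
qed

lemma poly_cheb_T_cos: "poly (cheb_T n) (cos \<theta>) = cos (real n * \<theta>)"
  using theI'[OF cheb_T_ex1[of n]] unfolding cheb_T_def by blast

definition arcsine_density :: "real \<Rightarrow> real" where
  "arcsine_density x = (if \<bar>x\<bar> < 1 then 1 / (pi * sqrt (1 - x\<^sup>2)) else 0)"

definition arcsine_law :: "real measure" where
  "arcsine_law = density lborel (\<lambda>x. ennreal (arcsine_density x))"

lemma borel_measurable_arcsine_density [measurable]: "arcsine_density \<in> borel_measurable borel"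
  unfolding arcsine_density_def by measurable

lemma real_distribution_arcsine_law: "real_distribution arcsine_law"
proof -
  have nonneg: "0 \<le> arcsine_density x" for x
    by (auto simp: arcsine_density_def abs_square_less_1 less_imp_le)
  have deriv: "((\<lambda>x. arcsin x / pi) has_real_derivative arcsine_density x) (at x)"
    if "-1 < x" "x < 1" for x
    using that by (auto intro!: derivative_eq_intros simp: arcsine_density_def field_simps)
  have cont: "isCont arcsine_density x" if "-1 < x" "x < 1" for x
  proof -
    have "isCont (\<lambda>x. 1 / (pi * sqrt (1 - x\<^sup>2))) x"
      using that abs_square_less_1[of x] by (auto intro!: continuous_intros simp: square_eq_1_iff power2_eq_1_iff)
    moreover have "\<forall>\<^sub>F y in nhds x. y \<in> {-1<..<1::real}"
      using that by (intro eventually_nhds_in_open) auto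
    then have "\<forall>\<^sub>F y in nhds x. arcsine_density y = 1 / (pi * sqrt (1 - y\<^sup>2))"
      by eventually_elim (auto simp: arcsine_density_def)
    ultimately show ?thesis
      using isCont_cong[of arcsine_density "\<lambda>x. 1 / (pi * sqrt (1 - x\<^sup>2))" x] by simp
  qed
  have lim: "((\<lambda>x. arcsin x / pi) \<longlongrightarrow> arcsin c / pi) (at c within {-1..1})"
    if "c \<in> {-1..1}" for c
    using continuous_on_arcsin' that
    by (auto intro!: tendsto_intros simp: continuous_on_def)
  have left: "((\<lambda>x. arcsin x / pi) \<longlongrightarrow> - (1/2)) (at_right (-1))"
    using lim[of "-1"] at_within_Icc_at_right[of "-1::real" 1] by simp
  have right: "((\<lambda>x. arcsin x / pi) \<longlongrightarrow> 1/2) (at_left 1)"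
    using lim[of "1"] at_within_Icc_at_left[of "-1::real" 1] by simp
  have L: "(((\<lambda>x. arcsin x / pi) \<circ> real_of_ereal) \<longlongrightarrow> - (1/2)) (at_right (ereal (-1)))"
    "(((\<lambda>x. arcsin x / pi) \<circ> real_of_ereal) \<longlongrightarrow> 1/2) (at_left (ereal 1))"
    using left right by (simp_all only: ereal_tendsto_simps1)
  have FTC: "set_integrable lborel (einterval (ereal (-1)) (ereal 1)) arcsine_density"
      "(LBINT x=ereal (-1)..ereal 1. arcsine_density x) = 1/2 - (- (1/2))"
    using interval_integral_FTC_nonneg[of "ereal (-1)" "ereal 1" "\<lambda>x. arcsin x / pi"
        arcsine_density "- (1/2)" "1/2"] deriv cont nonneg L by auto
  have ind: "indicator {-1<..<1} x *\<^sub>R arcsine_density x = arcsine_density x" for x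
    by (auto simp: arcsine_density_def indicator_def)
  have "integrable lborel arcsine_density" "(\<integral>x. arcsine_density x \<partial>lborel) = 1"
    using FTC by (simp_all add: set_integrable_def interval_lebesgue_integral_def
        set_lebesgue_integral_def ind del: real_scaleR_def)
  then have "(\<integral>\<^sup>+x. ennreal (arcsine_density x) \<partial>lborel) = 1"
    using nonneg by (simp add: nn_integral_eq_integral)
  then show ?thesis
    unfolding real_distribution_def real_distribution_axioms_def arcsine_law_def
    by (auto intro!: prob_spaceI simp: emeasure_density)
qed

end

theory Submission
  imports Defs "HOL-Computational_Algebra.Polynomial_Factorial" "HOL-Computational_Algebra.Field_as_Ring"
begin

text \<open>
  Following Markov and Stieltjes, the indicator function of \<open>[c, \<infinity>)\<close>, with \<open>c\<close> a node
  \<open>cos ((2j + 1) \<pi> / (2m))\<close>, is majorised on all of \<open>\<real>\<close> by the polynomial \<open>P\<close> of degree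
  at most \<open>2(m - 1)\<close> that agrees with it at all nodes, to second order at all nodes but \<open>c\<close>:
  any violation would yield more roots of \<open>P'\<close> than its degree permits. Discrete orthogonality
  of cosines evaluates the constant Chebyshev coefficient of \<open>P\<close> within \<open>O(1/m)\<close> of the
  arcsine mass of \<open>[c, \<infinity>)\<close>. As \<open>P\<close> lies above the indicator, the other coefficients differ
  from those of the indicator, which are \<open>O(1/n)\<close>, by \<open>O(1/m)\<close> only. Integrating \<open>P\<close> against \<open>\<mu>\<close>
  bounds \<open>\<mu>[x\<^sub>0, \<infinity>)\<close> from above, and the lower bound follows by reflecting \<open>\<mu>\<close>.
\<close>

section \<open>Counting roots of a polynomial and of its derivative\<close>

lemma card_roots_le_degree:
  fixes p :: "'a :: idom poly"
  assumes "p \<noteq> 0" "\<And>z. z \<in> Z \<Longrightarrow> poly p z = 0"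
  shows "card Z \<le> degree p"
proof -
  have "card Z \<le> card {x. poly p x = 0}"
    using assms by (intro card_mono poly_roots_finite) auto
  also have "\<dots> \<le> degree p"
    using assms(1) by (rule card_poly_roots_bound)
  finally show ?thesis .
qed

text \<open>Removing one factor \<open>[:-y, 1:]\<close> lowers the degree by one but loses no root
  in \<open>Z\<close>: if \<open>y\<close> lies in \<open>Z\<close>, the second factor still
  vanishes there.\<close>

lemma card_roots_less_degree:
  fixes p :: "'a :: idom poly"
  assumes "p \<noteq> 0" "\<And>z. z \<in> Z \<Longrightarrow> poly p z = 0" "[:-y, 1:] ^ 2 dvd p"
  shows "card Z < degree p"
proof -
  obtain q where q: "p = [:-y, 1:] ^ 2 * q"
    using assms(3) by (elim dvdE)
  define r where "r = [:-y, 1:] * q"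
  have p: "p = [:-y, 1:] * r"
    unfolding q r_def by (simp only: power2_eq_square mult.assoc)
  have "r \<noteq> 0" using assms(1) p by auto
  have "poly r z = 0" if "z \<in> Z" for z
    using assms(2)[OF that] by (simp add: p r_def)
  hence "card Z \<le> degree r"
    using \<open>r \<noteq> 0\<close> by (intro card_roots_le_degree)
  moreover have "degree p = Suc (degree r)"
    unfolding p using \<open>r \<noteq> 0\<close> by (subst degree_mult_eq) auto
  ultimately show ?thesis by simp
qed

lemma power_dvd_pderiv:
  fixes p :: "'a :: idom poly"
  assumes "q ^ Suc n dvd p"
  shows "q ^ n dvd pderiv p"
proof -
  obtain k where "p = q ^ Suc n * k"
    using assms by (elim dvdE)
  hence "pderiv p = q ^ n * (q * pderiv k + smult (of_nat (Suc n)) (pderiv q) * k)"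
    by (simp only: pderiv_mult pderiv_power_Suc) (simp add: algebra_simps)
  thus ?thesis by simp
qed

text \<open>Induction adds a new largest point \<open>b\<close>; Rolle's theorem on the interval
  from \<open>Max A\<close> to \<open>b\<close> supplies one more root. Disjointness from
  \<open>A\<close> and the strict bounds allow these roots to be counted together with prescribed
  ones.\<close>

lemma Rolle_roots:
  fixes p :: "real poly"
  assumes "finite A" "A \<noteq> {}" "\<And>a. a \<in> A \<Longrightarrow> poly p a = y"
  obtains Z where "finite Z" "card Z = card A - 1" "Z \<inter> A = {}"
    "\<And>z. z \<in> Z \<Longrightarrow> Min A < z \<and> z < Max A \<and> poly (pderiv p) z = 0"
proof -
  have "\<exists>Z. finite Z \<and> card Z = card A - 1 \<and> Z \<inter> A = {} \<and>
      (\<forall>z\<in>Z. Min A < z \<and> z < Max A \<and> poly (pderiv p) z = 0)"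
    using assms
  proof (induction A rule: finite_linorder_max_induct)
    case empty
    thus ?case by simp
  next
    case (insert b A)
    show ?case
    proof (cases "A = {}")
      case True
      thus ?thesis by (intro exI[of _ "{}"]) simp
    next
      case False
      with insert obtain Z where Z: "finite Z" "card Z = card A - 1" "Z \<inter> A = {}"
        "\<forall>z\<in>Z. Min A < z \<and> z < Max A \<and> poly (pderiv p) z = 0"
        by auto
      have less: "Max A < b" using insert.hyps False by simp
      have "poly p (Max A) = poly p b"
        using insert.prems insert.hyps False by (metis Max_in insertCI)
      then obtain z where z: "Max A < z" "z < b" "poly (pderiv p) z = 0"
        using poly_MVT[OF less, of p] by auto
      have "Min A \<le> Max A"
        using insert.hyps False by simp
      moreover have "z \<notin> Z" "z \<notin> insert b A" "b \<notin> Z"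
      proof -
        show "z \<notin> Z" using z Z(4) by fastforce
        show "z \<notin> insert b A" using z Max_ge[OF insert.hyps(1), of z] by auto
        show "b \<notin> Z" using less Z(4) by fastforce
      qed
      moreover have "Min (insert b A) = Min A" "Max (insert b A) = b"
        using insert.hyps False less \<open>Min A \<le> Max A\<close> by (simp_all add: min_absorb2 max_absorb1 del: Max_less_iff)
      moreover have "card (insert b A) = Suc (card A)" "card A > 0" "b \<notin> A"
        using insert.hyps False by (auto simp: card_gt_0_iff)
      ultimately show ?thesis
        using Z z less by (intro exI[of _ "insert z Z"]) fastforce
    qed
  qed
  thus ?thesis using that by blast
qed

section \<open>The one-sided interpolation polynomial\<close>

text \<open>Bezout's identity yields \<open>P\<close> divisible by \<open>w ^ 2\<close> with
  \<open>P - 1\<close> divisible by \<open>v ^ 2 * [:-c, 1:]\<close>. Its derivative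
  \<open>D\<close> vanishes on \<open>A\<close> and \<open>B\<close>, and by Rolle between
  neighbouring nodes of \<open>A\<close> and of \<open>insert c B\<close>. For nonempty
  \<open>A\<close> these are \<open>2 * (card A + card B) - 1\<close> roots, the largest possible
  degree of \<open>D\<close>, so a crossing on the wrong side would force one root too many.\<close>

lemma one_sided_interpolation:
  fixes A B :: "real set" and c :: real
  assumes fin: "finite A" "finite B" and A: "A \<noteq> {}"
    and less: "\<And>a. a \<in> A \<Longrightarrow> a < c" "\<And>b. b \<in> B \<Longrightarrow> c < b"
  obtains P :: "real poly" where
    "degree P \<le> 2 * (card A + card B)"
    "\<And>a. a \<in> A \<Longrightarrow> poly P a = 0" "\<And>b. b \<in> insert c B \<Longrightarrow> poly P b = 1"
    "\<And>x. of_bool (c \<le> x) \<le> poly P x"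
proof -
  define w where "w = (\<Prod>a\<in>A. [:-a, 1:])"
  define v where "v = (\<Prod>b\<in>B. [:-b, 1:])"
  define G where "G = v ^ 2 * [:-c, 1:]"
  have cop: "coprime [:-a, 1:] [:-b, 1:]" if "a \<noteq> b" for a b :: real
  proof (rule coprimeI)
    fix d assume d: "d dvd [:-a, 1:]" "d dvd [:-b, 1:]"
    hence "d dvd [:-a, 1:] - [:-b, 1:]" by (rule dvd_diff)
    hence "d dvd [:b - a:]" by simp
    moreover have "is_unit [:b - a:]" using that by (simp add: is_unit_const_poly_iff dvd_field_iff)
    ultimately show "is_unit d" by (rule dvd_unit_imp_unit)
  qed
  have "coprime (w ^ 2) G"
  proof -
    have "coprime w v"
      unfolding w_def v_def using less
      by (intro prod_coprime_left prod_coprime_right cop) fastforce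
    moreover have "coprime w [:-c, 1:]"
      unfolding w_def using less by (intro prod_coprime_left cop) fastforce
    ultimately show ?thesis
      unfolding G_def by (simp del: mult_pCons_right)
  qed
  then obtain u t where ut: "u * w ^ 2 + t * G = 1"
    using bezout_coefficients_fst_snd[of "w ^ 2" G] by (metis coprime_iff_gcd_eq_1)
  have w0: "w \<noteq> 0" and v0: "v \<noteq> 0"
    using fin by (auto simp: w_def v_def)
  have degw: "degree w = card A" and degv: "degree v = card B"
    unfolding w_def v_def by (simp_all add: degree_prod_eq_sum_degree)
  have degG: "degree G = 2 * card B + 1"
    unfolding G_def using v0 by (simp add: degree_mult_eq degree_power_eq degv del: mult_pCons_right)
  hence G0: "G \<noteq> 0" by auto
  \<comment> \<open>Reducing the Bezout coefficient \<open>u\<close> modulo \<open>G\<close>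
    preserves the congruence of \<open>w ^ 2 * u\<close> to 1 and brings the degree down;
    \<open>S\<close> absorbs the discarded multiple of \<open>G\<close>.\<close>
  define R where "R = u mod G"
  define S where "S = - t - w ^ 2 * (u div G)"
  define P where "P = w ^ 2 * R"
  have PS: "P - 1 = G * S"
  proof -
    have "w ^ 2 * u = w ^ 2 * (G * (u div G) + R)" by (simp add: R_def)
    thus ?thesis using ut unfolding P_def S_def by (simp add: algebra_simps)
  qed
  have degR: "degree R \<le> 2 * card B"
    unfolding R_def using degree_mod_less'[OF G0, of u] degG
    by (cases "u mod G = 0") auto
  have degP: "degree P \<le> 2 * (card A + card B)"
  proof -
    have "degree P \<le> degree (w ^ 2) + degree R"
      unfolding P_def by (rule degree_mult_le)
    also have "degree (w ^ 2) = 2 * card A"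
      using w0 by (simp add: degree_power_eq degw)
    finally show ?thesis using degR by simp
  qed
  have wA: "poly w x = 0 \<longleftrightarrow> x \<in> A" for x
    using fin by (simp add: w_def poly_prod)
  have vB: "poly v x = 0 \<longleftrightarrow> x \<in> B" for x
    using fin by (simp add: v_def poly_prod)
  have PA: "poly P a = 0" if "a \<in> A" for a
    using that wA by (simp add: P_def)
  have P_S: "poly P x = 1 + poly v x ^ 2 * (x - c) * poly S x" for x
  proof -
    have "poly (P - 1) x = poly (G * S) x" by (simp only: PS)
    thus ?thesis by (simp add: G_def algebra_simps)
  qed
  have PB: "poly P b = 1" if "b \<in> insert c B" for b
    using that vB by (auto simp: P_S)
  define D where "D = pderiv P"
  have dvdA: "[:-a, 1:] ^ 2 dvd w ^ 2" if "a \<in> A" for a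
    unfolding w_def using fin that by (intro dvd_power_same dvd_prodI)
  have dvdB: "[:-b, 1:] ^ 2 dvd v ^ 2" if "b \<in> B" for b
    unfolding v_def using fin that by (intro dvd_power_same dvd_prodI)
  \<comment> \<open>\<open>P\<close> is nonconstant: it is 0 on the nonempty set \<open>A\<close>
    and 1 at \<open>c\<close>.\<close>
  have "D \<noteq> 0"
  proof
    assume "D = 0"
    then obtain h where h: "P = [:h:]" by (auto simp: D_def pderiv_eq_0_iff elim: degree_eq_zeroE)
    obtain a where "a \<in> A" using A by auto
    with PA[of a] PB[of c] h show False by simp
  qed
  have degD: "degree D < 2 * (card A + card B)"
  proof -
    have "card A > 0" using fin A by (simp add: card_gt_0_iff)
    thus ?thesis using degP unfolding D_def degree_pderiv by arith
  qed
  have D1: "D = pderiv (P - 1)" by (simp add: D_def pderiv_diff)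
  have DA: "poly D a = 0" if "a \<in> A" for a
    using power_dvd_pderiv[of "[:-a, 1:]" 1 P] dvdA[OF that]
    by (simp add: P_def D_def poly_eq_0_iff_dvd numeral_2_eq_2)
  have DB: "poly D b = 0" if "b \<in> B" for b
  proof -
    have "[:-b, 1:] ^ Suc 1 dvd P - 1"
      using dvdB[OF that] unfolding PS G_def by (simp only: dvd_mult2 Suc_1)
    from power_dvd_pderiv[OF this] show ?thesis by (simp add: D1 poly_eq_0_iff_dvd)
  qed
  have MaxA: "Max A < c" and MaxinA: "Max A \<in> A" using fin A less by auto
  text \<open>Rolle's theorem gives \<open>D\<close> as many roots as its degree permits.\<close>
  have count: False
    if A': "finite A'" "A \<subseteq> A'" "\<And>x. x \<in> A' \<Longrightarrow> x < c" "\<And>x. x \<in> A' \<Longrightarrow> poly P x = 0"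
      and B': "finite B'" "insert c B \<subseteq> B'" "\<And>x. x \<in> B' \<Longrightarrow> Max A < x" "\<And>x. x \<in> B' \<Longrightarrow> poly P x = 1"
      and ord: "Max A' < Min B'"
      and extra: "card A' + card B' > card A + card B + 1 \<or> poly D c = 0 \<or> (\<exists>y. [:-y, 1:] ^ 2 dvd D)"
    for A' B'
  proof -
    have A'0: "A' \<noteq> {}" and B'0: "B' \<noteq> {}" using A A' B' by auto
    obtain X where X: "finite X" "card X = card A' - 1" "X \<inter> A' = {}"
      "\<And>z. z \<in> X \<Longrightarrow> Min A' < z \<and> z < Max A' \<and> poly (pderiv P) z = 0"
      using Rolle_roots[OF A'(1) A'0 A'(4)] by blast
    obtain Y where Y: "finite Y" "card Y = card B' - 1" "Y \<inter> B' = {}"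
      "\<And>z. z \<in> Y \<Longrightarrow> Min B' < z \<and> z < Max B' \<and> poly (pderiv P) z = 0"
      using Rolle_roots[OF B'(1) B'0 B'(4)] by blast
    \<comment> \<open>\<open>A\<close> and \<open>B\<close> are zeros of \<open>D\<close> by
      second-order contact, \<open>X\<close> and \<open>Y\<close> by Rolle. Since all of
      \<open>A'\<close> lies below all of \<open>B'\<close>, the four sets are disjoint, and none
      contains \<open>c\<close>.\<close>
    define Z where "Z = (A \<union> B) \<union> (X \<union> Y)"
    have XY: "X \<inter> Y = {}" using X(4) Y(4) ord by fastforce
    have AY: "A \<inter> Y = {}"
    proof -
      have "Max A \<le> Max A'" using A A' by (intro Max_mono)
      thus ?thesis using Y(4) ord fin by (fastforce dest: Max_ge[OF fin(1)])
    qed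
    have BX: "B \<inter> X = {}"
    proof -
      have "Max A' < c" using A'(1,3) A'0 by simp
      thus ?thesis using X(4) less(2) by fastforce
    qed
    have cZ: "c \<notin> Z"
    proof -
      have "Max A' < c" using A'(1,3) A'0 by simp
      thus ?thesis using X(4) Y(3) B'(2) less unfolding Z_def by fastforce
    qed
    have AB: "A \<inter> B = {}" using less by fastforce
    have "card Z = (card A + card B) + (card X + card Y)"
      unfolding Z_def using fin X(1,3) Y(1,3) A'(2) B'(2) XY AY BX AB
      by (subst card_Un_disjoint card_Un_disjoint | blast | simp)+
    moreover have "card A' \<ge> 1" "card B' \<ge> 1" using A'0 B'0 A' B' by (simp_all add: Suc_le_eq card_gt_0_iff)
    moreover have "card A' \<ge> card A" "card B' \<ge> card B + 1"
    proof -
      show "card A' \<ge> card A" using A' by (simp add: card_mono)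
      have "card (insert c B) = card B + 1" using less fin by (subst card_insert_disjoint) auto
      thus "card B' \<ge> card B + 1" using B' by (metis card_mono)
    qed
    ultimately have cardZ: "card Z + 2 = (card A + card B) + (card A' + card B')"
      and cardZ': "card Z \<ge> 2 * (card A + card B) - 1"
      using X(2) Y(2) by simp_all
    have DZ: "poly D z = 0" if "z \<in> Z" for z
      using that DA DB X(4) Y(4) unfolding Z_def D_def by auto
    \<comment> \<open>\<open>Z\<close> already exhausts the degree of \<open>D\<close>. Each
      alternative supplies one root more: an additional node, the point \<open>c\<close> outside
      \<open>Z\<close>, or a root of multiplicity two.\<close>
    from extra show False
    proof (elim disjE exE)
      assume "card A' + card B' > card A + card B + 1"
      with cardZ have "card Z \<ge> 2 * (card A + card B)" by simp
      moreover have "card Z \<le> degree D"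
        using DZ by (rule card_roots_le_degree[OF \<open>D \<noteq> 0\<close>])
      ultimately show False using degD by simp
    next
      assume "poly D c = 0"
      with DZ have "card (insert c Z) \<le> degree D"
        by (intro card_roots_le_degree \<open>D \<noteq> 0\<close>) auto
      moreover have "card (insert c Z) = Suc (card Z)"
        using cZ fin X(1) Y(1) by (simp add: Z_def)
      ultimately show False using cardZ' degD by simp
    next
      fix y assume "[:-y, 1:] ^ 2 dvd D"
      hence "card Z < degree D"
        using DZ by (intro card_roots_less_degree[OF \<open>D \<noteq> 0\<close>])
      with cardZ' degD show False by simp
    qed
  qed
  \<comment> \<open>A negative value makes \<open>R\<close> change sign between \<open>x\<close> and
    \<open>c\<close>. The resulting zero \<open>z\<close> of \<open>P\<close> is either a new node,
    or lies in \<open>A\<close> and is then a triple zero of \<open>P\<close>, hence a double zero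
    of \<open>D\<close>.\<close>
  have left: "poly P x \<ge> 0" if xc: "x < c" for x
  proof (rule ccontr)
    assume neg: "\<not> poly P x \<ge> 0"
    have "poly R x < 0"
      using neg by (simp add: P_def mult_less_0_iff not_le)
    moreover have "poly R c > 0"
    proof -
      have "poly w c ^ 2 * poly R c = 1" using PB[of c] by (simp add: P_def)
      thus ?thesis by (metis zero_less_mult_pos zero_less_one zero_less_power2 mult_zero_left power_zero_numeral zero_neq_one)
    qed
    ultimately obtain z where z: "x < z" "z < c" "poly R z = 0"
      using poly_IVT_pos[OF xc] by blast
    have Pz: "poly P z = 0" using z by (simp add: P_def)
    show False
    proof (rule count[of "insert z A" "insert c B"])
      show "Max (insert z A) < Min (insert c B)"
      proof -
        have "Max (insert z A) < c" using fin less(1) z by auto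
        moreover have "Min (insert c B) = c" using fin less(2) by (intro Min_eqI) (auto intro: less_imp_le)
        ultimately show ?thesis by simp
      qed
      show "card (insert z A) + card (insert c B) > card A + card B + 1 \<or> poly D c = 0 \<or> (\<exists>y. [:-y, 1:] ^ 2 dvd D)"
      proof (cases "z \<in> A")
        case True
        have "[:-z, 1:] ^ 2 * [:-z, 1:] dvd P"
          unfolding P_def using dvdA[OF True] z(3) by (intro mult_dvd_mono) (simp_all add: poly_eq_0_iff_dvd)
        hence "[:-z, 1:] ^ Suc 2 dvd P" by (simp only: power_Suc2)
        from power_dvd_pderiv[OF this] show ?thesis unfolding D_def by blast
      next
        case False
        moreover have "c \<notin> B" using less by auto
        ultimately show ?thesis using fin by simp
      qed
    qed (use fin less z PA PB Pz MaxA in \<open>auto intro: order.strict_trans\<close>)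
  qed
  \<comment> \<open>A value below 1 makes \<open>S\<close> change sign between \<open>Max A\<close>
    and \<open>x\<close>. The zero \<open>z\<close> of \<open>S\<close> is a new point with
    \<open>P = 1\<close>, or a triple zero of \<open>P - 1\<close> if in \<open>B\<close>, or
    \<open>c\<close> itself, where \<open>P - 1\<close> then has a double zero. As \<open>z\<close>
    may fall below \<open>c\<close>, \<open>count\<close> asks only that \<open>B'\<close> lie above
    \<open>Max A\<close>.\<close>
  have right: "poly P x \<ge> 1" if xc: "x > c" for x
  proof (rule ccontr)
    assume neg: "\<not> poly P x \<ge> 1"
    have "(poly v x ^ 2 * (x - c)) * poly S x < 0"
      using neg by (simp add: P_S not_le)
    hence Sx: "poly S x < 0"
      using xc by (auto simp: mult_less_0_iff)
    define a where "a = Max A"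
    have a: "a < c" "poly P a = 0" using MaxA MaxinA PA by (auto simp: a_def)
    have "(poly v a ^ 2 * (c - a)) * poly S a = 1"
      using a(2) by (simp add: P_S algebra_simps)
    hence Sa: "poly S a > 0"
      using a(1) by (smt (verit) mult_nonneg_nonneg mult_nonneg_nonpos zero_le_power2)
    obtain z where z: "a < z" "z < x" "poly S z = 0"
      using poly_IVT_neg[of a x S] a xc Sa Sx by auto
    have Pz: "poly P z = 1" using z by (simp add: P_S)
    show False
    proof (rule count[of A "insert z (insert c B)"])
      show "Max A < Min (insert z (insert c B))"
        using fin less z MaxA by (subst Min_gr_iff; force simp: a_def)
      show "card A + card (insert z (insert c B)) > card A + card B + 1 \<or> poly D c = 0 \<or> (\<exists>y. [:-y, 1:] ^ 2 dvd D)"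
      proof (cases "z \<in> B")
        case True
        have "[:-z, 1:] ^ 2 * [:-z, 1:] dvd (v ^ 2 * [:-c, 1:]) * S"
          using dvdB[OF True] z(3) by (intro mult_dvd_mono dvd_mult2) (simp_all add: poly_eq_0_iff_dvd)
        hence "[:-z, 1:] ^ Suc 2 dvd P - 1" by (simp only: power_Suc2 PS G_def)
        from power_dvd_pderiv[OF this] show ?thesis unfolding D1 by blast
      next
        case zB: False
        have cB: "c \<notin> B" using less by auto
        show ?thesis
        proof (cases "z = c")
          case True
          hence "poly (pderiv (P - 1)) c = 0"
            unfolding PS G_def using z(3) by (simp add: pderiv_mult)
          thus ?thesis by (simp add: D1)
        next
          case False
          thus ?thesis using zB cB fin by simp
        qed
      qed
    qed (use fin less z PA PB Pz MaxA in \<open>auto simp: a_def intro: order.strict_trans\<close>)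
  qed
  have "of_bool (c \<le> x) \<le> poly P x" for x
    using left[of x] right[of x] PB[of c] by (cases x c rule: linorder_cases) auto
  with degP PA PB show ?thesis by (rule that)
qed

section \<open>Chebyshev polynomials: recurrence, degree, parity, expansion\<close>

lemma cheb_T_eqI:
  assumes "\<And>\<theta>. poly p (cos \<theta>) = cos (real n * \<theta>)"
  shows "cheb_T n = p"
  using cheb_T_ex1[of n] assms poly_cheb_T_cos[of n] by blast

lemma cheb_T_0: "cheb_T 0 = 1"
  by (rule cheb_T_eqI) simp

lemma cheb_T_1: "cheb_T 1 = [:0, 1:]"
  by (rule cheb_T_eqI) simp

lemma cheb_T_Suc_Suc: "cheb_T (Suc (Suc n)) = [:0, 2:] * cheb_T (Suc n) - cheb_T n"
proof (rule cheb_T_eqI)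
  fix \<theta> :: real
  have "cos (real (Suc n) * \<theta> + \<theta>) + cos (real (Suc n) * \<theta> - \<theta>) = 2 * cos \<theta> * cos (real (Suc n) * \<theta>)"
    by (simp only: cos_add cos_diff) simp
  moreover have "real (Suc n) * \<theta> + \<theta> = real (Suc (Suc n)) * \<theta>" "real (Suc n) * \<theta> - \<theta> = real n * \<theta>"
    by (simp_all add: algebra_simps)
  ultimately show "poly ([:0, 2:] * cheb_T (Suc n) - cheb_T n) (cos \<theta>) = cos (real (Suc (Suc n)) * \<theta>)"
    by (simp add: poly_cheb_T_cos del: of_nat_Suc)
qed

lemma degree_cheb_T: "degree (cheb_T n) = n"
proof (induction n rule: induct_nat_012)
  case (ge2 n)
  hence "cheb_T (Suc n) \<noteq> 0" by auto
  hence "degree ([:0, 2:] * cheb_T (Suc n)) = Suc (Suc n)"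
    using ge2 by (subst degree_mult_eq) auto
  hence "degree ([:0, 2:] * cheb_T (Suc n) + - cheb_T n) = Suc (Suc n)"
    using ge2 by (subst degree_add_eq_left) auto
  thus ?case by (simp only: cheb_T_Suc_Suc diff_conv_add_uminus)
qed (simp_all add: cheb_T_0 cheb_T_1[simplified])

lemma poly_cheb_T_minus: "poly (cheb_T n) (- x) = (-1) ^ n * poly (cheb_T n) x"
  by (induction n rule: induct_nat_012) (simp_all add: cheb_T_0 cheb_T_1[simplified] cheb_T_Suc_Suc algebra_simps)

lemma cheb_T_expansion:
  assumes "degree p \<le> d"
  shows "\<exists>a. p = (\<Sum>n\<le>d. smult (a n) (cheb_T n))"
  using assms
proof (induction d arbitrary: p)
  case 0
  then obtain c where "p = [:c:]" by (auto elim: degree_eq_zeroE)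
  hence "p = smult (coeff p 0) (cheb_T 0)" by (simp add: cheb_T_0)
  thus ?case by (intro exI[of _ "coeff p"]) simp
next
  case (Suc d)
  define c where "c = coeff p (Suc d) / lead_coeff (cheb_T (Suc d))"
  define q where "q = p - smult c (cheb_T (Suc d))"
  have "lead_coeff (cheb_T (Suc d)) \<noteq> 0"
    using degree_cheb_T[of "Suc d"] unfolding leading_coeff_0_iff by auto
  hence "coeff q (Suc d) = 0"
    by (simp add: q_def c_def degree_cheb_T)
  moreover have "degree q \<le> Suc d"
    unfolding q_def using Suc.prems by (intro degree_diff_le) (auto simp: degree_cheb_T)
  ultimately have "degree q \<le> d"
    using leading_coeff_0_iff[of q] by (cases "degree q = Suc d") auto
  from Suc.IH[OF this] obtain a where a: "q = (\<Sum>n\<le>d. smult (a n) (cheb_T n))" by blast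
  have "p = (\<Sum>n\<le>Suc d. smult ((a(Suc d := c)) n) (cheb_T n))"
    using a by (simp add: q_def algebra_simps)
  thus ?case by blast
qed

section \<open>Discrete and continuous orthogonality of cosines\<close>

text \<open>The angles belong to the zeros of \<open>cheb_T m\<close>. With
  \<open>h = real n * pi / (2 * real m)\<close>, multiplication by \<open>2 * sin h\<close>
  telescopes the sum to \<open>sin (real n * pi) = 0\<close>; the range of \<open>n\<close> puts
  \<open>h\<close> strictly between 0 and \<open>pi\<close>, so \<open>sin h\<close> can be
  cancelled.\<close>

lemma sum_cos_odd_multiples:
  assumes "0 < n" "n < 2 * m"
  shows "(\<Sum>j<m. cos (real n * ((2 * real j + 1) * pi / (2 * real m)))) = 0"
proof -
  define h where "h = real n * pi / (2 * real m)"
  have m: "m > 0" using assms by simp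
  have "0 < h" "h < pi"
    using assms m by (simp_all add: h_def field_simps)
  hence "sin h \<noteq> 0" using sin_gt_zero[of h] by simp
  have "2 * sin h * cos (real n * ((2 * real j + 1) * pi / (2 * real m))) =
      sin (2 * real (Suc j) * h) - sin (2 * real j * h)" for j
  proof -
    define y where "y = real n * ((2 * real j + 1) * pi / (2 * real m))"
    have "2 * real (Suc j) * h = y + h" "2 * real j * h = y - h"
      by (simp_all add: y_def h_def add_divide_distrib algebra_simps)
    moreover have "2 * sin h * cos y = sin (y + h) - sin (y - h)"
      by (simp add: sin_add sin_diff)
    ultimately show ?thesis by (simp only: y_def)
  qed
  hence "2 * sin h * (\<Sum>j<m. cos (real n * ((2 * real j + 1) * pi / (2 * real m)))) =
      (\<Sum>j<m. sin (2 * real (Suc j) * h) - sin (2 * real j * h))"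
    by (simp only: sum_distrib_left)
  also have "\<dots> = sin (2 * real m * h) - sin (2 * real 0 * h)"
    by (rule sum_lessThan_telescope)
  also have "2 * real m * h = real n * pi" using m by (simp add: h_def)
  finally show ?thesis using \<open>sin h \<noteq> 0\<close> by simp
qed

lemma has_integral_cos_of_nat:
  assumes "n > 0" "0 \<le> t"
  shows "((\<lambda>\<theta>. cos (real n * \<theta>)) has_integral sin (real n * t) / real n) {0..t}"
proof -
  have "((\<lambda>\<theta>. cos (real n * \<theta>)) has_integral (sin (real n * t) / real n - sin (real n * 0) / real n)) {0..t}"
    using assms by (intro fundamental_theorem_of_calculus)
      (auto intro!: derivative_eq_intros simp flip: has_real_derivative_iff_has_vector_derivative)
  thus ?thesis by simp
qed

lemma has_integral_cos_of_nat_pi: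
  "((\<lambda>\<theta>. cos (real n * \<theta>)) has_integral (if n = 0 then pi else 0)) {0..pi}"
  using has_integral_cos_of_nat[of n pi] has_integral_const_real[of "1::real" 0 pi] by auto

lemma has_integral_cos_mult_cos:
  assumes "n > 0"
  shows "((\<lambda>\<theta>. cos (real j * \<theta>) * cos (real n * \<theta>)) has_integral (if j = n then pi / 2 else 0)) {0..pi}"
proof -
  \<comment> \<open>The absolute difference as a natural number; cosine is even, so the sign is
    immaterial in the product formula.\<close>
  define d where "d = (if j \<le> n then n - j else j - n)"
  have "cos (real j * \<theta>) * cos (real n * \<theta>) = (cos (real (j + n) * \<theta>) + cos (real d * \<theta>)) / 2" for \<theta>
  proof -
    have "cos (real d * \<theta>) = cos (real j * \<theta> - real n * \<theta>)"
    proof (cases "j \<le> n")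
      case True
      hence "real d * \<theta> = - (real j * \<theta> - real n * \<theta>)" by (simp add: d_def of_nat_diff algebra_simps)
      thus ?thesis by (simp only: cos_minus)
    qed (simp add: d_def of_nat_diff algebra_simps)
    moreover have "real (j + n) * \<theta> = real j * \<theta> + real n * \<theta>" by (simp add: algebra_simps)
    ultimately show ?thesis by (simp only: cos_add cos_diff) simp
  qed
  moreover have "((\<lambda>\<theta>. (cos (real (j + n) * \<theta>) + cos (real d * \<theta>)) / 2) has_integral
      ((if j + n = 0 then pi else 0) + (if d = 0 then pi else 0)) / 2) {0..pi}"
    by (intro has_integral_divide has_integral_add has_integral_cos_of_nat_pi)
  moreover have "d = 0 \<longleftrightarrow> j = n" by (auto simp: d_def)
  ultimately show ?thesis using assms by (simp only:) (simp split: if_splits)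
qed

section \<open>Chebyshev coefficients of a majorant\<close>

text \<open>After substituting \<open>cos \<theta>\<close>, the gap \<open>h\<close> between
  \<open>p\<close> and the indicator of \<open>{0..t}\<close> is nonnegative on
  \<open>{0..pi}\<close>, so its cosine moments are at most its integral \<open>pi * a 0 - t\<close>
  in absolute value. The \<open>n\<close>-th moment is \<open>a n * pi / 2\<close> minus the moment
  \<open>sin (real n * t) / real n\<close> of the indicator.\<close>

lemma cheb_coeff_bound:
  fixes a :: "nat \<Rightarrow> real"
  assumes p: "\<And>x. poly p x = (\<Sum>j\<le>d. a j * poly (cheb_T j) x)"
    and maj: "\<And>x. of_bool (cos t \<le> x) \<le> poly p x"
    and t: "0 \<le> t" "t \<le> pi" and n: "0 < n" "n \<le> d"
  shows "\<bar>a n\<bar> \<le> 2 * (a 0 - t / pi) + 1 / real n"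
proof -
  let ?s = "\<lambda>f \<theta>. if \<theta> \<in> {0..t} then f \<theta> else (0::real)"
  define h where "h = (\<lambda>\<theta>. poly p (cos \<theta>) - ?s (\<lambda>_. 1) \<theta>)"
  have pc: "poly p (cos \<theta>) = (\<Sum>j\<le>d. a j * cos (real j * \<theta>))" for \<theta>
    by (simp add: p poly_cheb_T_cos)
  have h0: "h \<theta> \<ge> 0" if "\<theta> \<in> {0..pi}" for \<theta>
  proof -
    have "?s (\<lambda>_. 1) \<theta> \<le> of_bool (cos t \<le> cos \<theta>)"
      using that t by (auto simp: cos_monotone_0_pi_le)
    also have "\<dots> \<le> poly p (cos \<theta>)" by (rule maj)
    finally show ?thesis by (simp add: h_def)
  qed
  have "((\<lambda>\<theta>. poly p (cos \<theta>)) has_integral (\<Sum>j\<le>d. a j * (if j = 0 then pi else 0))) {0..pi}"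
    unfolding pc by (intro has_integral_sum has_integral_mult_right has_integral_cos_of_nat_pi) simp
  moreover have "(?s (\<lambda>_. 1) has_integral t) {0..pi}"
    using has_integral_const_real[of "1::real" 0 t] t by (subst has_integral_restrict) auto
  ultimately have I1: "(h has_integral pi * a 0 - t) {0..pi}"
    unfolding h_def by (auto dest: has_integral_diff simp: if_distrib[of "\<lambda>x. _ * x"] sum.delta mult.commute cong: if_cong)
  have "((\<lambda>\<theta>. poly p (cos \<theta>) * cos (real n * \<theta>)) has_integral (\<Sum>j\<le>d. a j * (if j = n then pi / 2 else 0))) {0..pi}"
    unfolding pc sum_distrib_right mult.assoc using n
    by (intro has_integral_sum has_integral_mult_right has_integral_cos_mult_cos) simp_all
  moreover have "(\<Sum>j\<le>d. a j * (if j = n then pi / 2 else 0)) = a n * pi / 2"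
    using n by (simp add: if_distrib[of "\<lambda>x. _ * x"] sum.delta' cong: if_cong)
  moreover have "(?s (\<lambda>\<theta>. cos (real n * \<theta>)) has_integral sin (real n * t) / real n) {0..pi}"
    using has_integral_cos_of_nat[of n t] t n by (subst has_integral_restrict) auto
  ultimately have "((\<lambda>\<theta>. poly p (cos \<theta>) * cos (real n * \<theta>) - ?s (\<lambda>\<theta>. cos (real n * \<theta>)) \<theta>)
      has_integral a n * pi / 2 - sin (real n * t) / real n) {0..pi}"
    by (simp only: has_integral_diff)
  moreover have "(\<lambda>\<theta>. poly p (cos \<theta>) * cos (real n * \<theta>) - ?s (\<lambda>\<theta>. cos (real n * \<theta>)) \<theta>) =
      (\<lambda>\<theta>. h \<theta> * cos (real n * \<theta>))"
    by (auto simp: h_def algebra_simps)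
  ultimately have I2: "((\<lambda>\<theta>. h \<theta> * cos (real n * \<theta>)) has_integral a n * pi / 2 - sin (real n * t) / real n) {0..pi}"
    by simp
  have "a n * pi / 2 - sin (real n * t) / real n \<le> pi * a 0 - t"
    using h0 by (intro has_integral_le[OF I2 I1] mult_left_le) auto
  moreover have "- (pi * a 0 - t) \<le> a n * pi / 2 - sin (real n * t) / real n"
  proof (rule has_integral_le[OF has_integral_neg[OF I1] I2])
    fix \<theta> assume "\<theta> \<in> {0..pi}"
    from mult_left_mono[OF cos_ge_minus_one h0[OF this]] show "- h \<theta> \<le> h \<theta> * cos (real n * \<theta>)" by simp
  qed
  moreover have "\<bar>sin (real n * t) / real n\<bar> \<le> 1 / real n"
    by (simp add: divide_right_mono)
  ultimately have "\<bar>a n * pi / 2\<bar> \<le> pi * a 0 - t + 1 / real n" by linarith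
  hence "\<bar>a n\<bar> * pi \<le> (2 * (a 0 - t / pi) + 2 / (pi * real n)) * pi"
    by (simp add: abs_mult algebra_simps)
  hence "\<bar>a n\<bar> \<le> 2 * (a 0 - t / pi) + 2 / (pi * real n)"
    by simp
  also have "2 / (pi * real n) \<le> 1 / real n"
    using n pi_ge_two by (simp add: field_simps)
  finally show ?thesis by simp
qed

section \<open>Tails of the arcsine law\<close>

text \<open>The antiderivative of the density is \<open>arcsin x / pi\<close>. The density is
  unbounded near the endpoints -1 and 1, so the fundamental theorem is applied on an open interval
  with one-sided limits; the single point \<open>x\<close> is a null set.\<close>

lemma measure_arcsine_law_atLeast:
  "measure arcsine_law {x..} = (if x \<le> -1 then 1 else if 1 \<le> x then 0 else arccos x / pi)"
proof -
  interpret real_distribution arcsine_law by (rule real_distribution_arcsine_law)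
  have nonneg: "0 \<le> arcsine_density x" for x
    by (auto simp: arcsine_density_def abs_square_less_1 less_imp_le)
  have main: "measure arcsine_law {x..} = 1 / 2 - arcsin x / pi" if x: "-1 \<le> x" "x < 1" for x
  proof -
    have deriv: "((\<lambda>x. arcsin x / pi) has_real_derivative arcsine_density x) (at x)"
      if "-1 < x" "x < 1" for x
      using that by (auto intro!: derivative_eq_intros simp: arcsine_density_def field_simps)
    have cont: "isCont arcsine_density x" if "-1 < x" "x < 1" for x
    proof -
      have "isCont (\<lambda>x. 1 / (pi * sqrt (1 - x\<^sup>2))) x"
        using that abs_square_less_1[of x] by (auto intro!: continuous_intros simp: square_eq_1_iff power2_eq_1_iff)
      moreover have "\<forall>\<^sub>F y in nhds x. y \<in> {-1<..<1::real}"
        using that by (intro eventually_nhds_in_open) auto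
      then have "\<forall>\<^sub>F y in nhds x. arcsine_density y = 1 / (pi * sqrt (1 - y\<^sup>2))"
        by eventually_elim (auto simp: arcsine_density_def)
      ultimately show ?thesis
        using isCont_cong[of arcsine_density "\<lambda>x. 1 / (pi * sqrt (1 - x\<^sup>2))" x] by simp
    qed
    have lim: "((\<lambda>x. arcsin x / pi) \<longlongrightarrow> arcsin c / pi) (at c within {x..1})"
      if "c \<in> {x..1}" for c
    proof -
      have "continuous_on {x..1} arcsin"
        using x by (intro continuous_on_subset[OF continuous_on_arcsin']) auto
      thus ?thesis using that
        by (auto intro!: tendsto_intros simp: continuous_on_def)
    qed
    have left: "((\<lambda>x. arcsin x / pi) \<longlongrightarrow> arcsin x / pi) (at_right x)"
      using lim[of x] at_within_Icc_at_right[of x 1] x by simp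
    have right: "((\<lambda>x. arcsin x / pi) \<longlongrightarrow> 1/2) (at_left 1)"
      using lim[of 1] at_within_Icc_at_left[of x 1] x by simp
    have L: "(((\<lambda>x. arcsin x / pi) \<circ> real_of_ereal) \<longlongrightarrow> arcsin x / pi) (at_right (ereal x))"
      "(((\<lambda>x. arcsin x / pi) \<circ> real_of_ereal) \<longlongrightarrow> 1/2) (at_left (ereal 1))"
      using left right by (simp_all only: ereal_tendsto_simps1)
    have FTC: "set_integrable lborel (einterval (ereal x) (ereal 1)) arcsine_density"
        "(LBINT y=ereal x..ereal 1. arcsine_density y) = 1/2 - arcsin x / pi"
      using interval_integral_FTC_nonneg[of "ereal x" "ereal 1" "\<lambda>x. arcsin x / pi"
          arcsine_density "arcsin x / pi" "1/2"] deriv cont nonneg L x by auto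
    have "measure arcsine_law {x..} = measure arcsine_law {x<..<1}"
    proof -
      have "emeasure arcsine_law {x..} = (\<integral>\<^sup>+y. ennreal (arcsine_density y) * indicator {x..} y \<partial>lborel)"
        unfolding arcsine_law_def by (subst emeasure_density) auto
      also have "\<dots> = (\<integral>\<^sup>+y. ennreal (arcsine_density y) * indicator {x<..<1} y \<partial>lborel)"
        using AE_lborel_singleton[of x] by (intro nn_integral_cong_AE)
          (auto elim!: eventually_mono simp: indicator_def arcsine_density_def)
      also have "\<dots> = emeasure arcsine_law {x<..<1}"
        unfolding arcsine_law_def by (subst emeasure_density) auto
      finally show ?thesis by (simp add: measure_def)
    qed
    also have "\<dots> = (LINT y:{x<..<1}|lborel. arcsine_density y)"
    proof -
      have "emeasure arcsine_law {x<..<1} = (\<integral>\<^sup>+y. ennreal (indicator {x<..<1} y *\<^sub>R arcsine_density y) \<partial>lborel)"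
        unfolding arcsine_law_def
        by (subst emeasure_density) (auto intro!: nn_integral_cong simp: indicator_def)
      also have "\<dots> = ennreal (LINT y:{x<..<1}|lborel. arcsine_density y)"
        unfolding set_lebesgue_integral_def using FTC(1) nonneg
        by (intro nn_integral_eq_integral) (auto simp: set_integrable_def)
      finally show ?thesis
        using nonneg by (simp add: measure_def set_lebesgue_integral_def enn2real_ennreal integral_nonneg_AE)
    qed
    also have "\<dots> = 1/2 - arcsin x / pi"
      using FTC(2) x by (simp add: interval_lebesgue_integral_def)
    finally show ?thesis .
  qed
  have m1: "measure arcsine_law {-1..} = 1"
    using main[of "-1"] by simp
  consider "x \<le> -1" | "1 \<le> x" | "-1 < x" "x < 1" by linarith
  thus ?thesis
  proof cases
    case 1
    hence "measure arcsine_law {-1..} \<le> measure arcsine_law {x..}"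
      by (intro finite_measure_mono) auto
    with m1 1 show ?thesis using prob_le_1[of "{x..}"] by simp
  next
    case 2
    have "emeasure arcsine_law {x..} = (\<integral>\<^sup>+y. ennreal (arcsine_density y) * indicator {x..} y \<partial>lborel)"
      unfolding arcsine_law_def by (subst emeasure_density) auto
    also have "\<dots> = (\<integral>\<^sup>+y. 0 \<partial>(lborel :: real measure))"
      using 2 by (intro nn_integral_cong) (auto simp: indicator_def arcsine_density_def)
    finally show ?thesis using 2 by (simp add: measure_def)
  next
    case 3
    thus ?thesis using main[of x] by (simp add: arccos_arcsin_eq diff_divide_distrib)
  qed
qed

section \<open>The majorant with Chebyshev nodes\<close>

text \<open>The interpolation node is the largest zero of \<open>cheb_T m\<close> not exceeding
  \<open>x0\<close>. Neighbouring zeros differ by \<open>pi / m\<close> in angle, so moving from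
  \<open>x0\<close> to the node costs only \<open>O(1/m)\<close> of arcsine mass.\<close>

lemma cheb_T_majorant:
  assumes m: "0 < m"
  obtains a :: "nat \<Rightarrow> real" where
    "\<And>x. of_bool (x0 \<le> x) \<le> (\<Sum>n\<le>2 * (m - 1). a n * poly (cheb_T n) x)"
    "a 0 \<le> measure arcsine_law {x0..} + 2 / real m"
    "\<And>n. 0 < n \<Longrightarrow> n \<le> 2 * (m - 1) \<Longrightarrow> \<bar>a n\<bar> \<le> 3 / real n"
\<comment> \<open>If the tail is within \<open>2 / real m\<close> of 1, the constant 1 is a good
  enough majorant. Otherwise at least one node lies below the chosen one, as the interpolation
  requires.\<close>
proof (cases "1 - 2 / real m \<le> measure arcsine_law {x0..}")
  case True
  show ?thesis
  proof (rule that[of "\<lambda>n. of_bool (n = 0)"])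
    show "of_bool (x0 \<le> x) \<le> (\<Sum>n\<le>2 * (m - 1). of_bool (n = 0) * poly (cheb_T n) x)" for x
      by (simp add: of_bool_def if_distrib[of "\<lambda>y. y * _"] sum.delta cheb_T_0 cong: if_cong)
  qed (use True in auto)
next
  case False
  \<comment> \<open>The angle of \<open>x0\<close>, set to 0 from 1 on, so that the arcsine tail is
    \<open>t / pi\<close> throughout; hence \<open>cos t \<le> x0\<close> rather than
    equality.\<close>
  define t where "t = (if 1 \<le> x0 then 0 else arccos x0)"
  have "x0 > -1" using False by (auto simp: measure_arcsine_law_atLeast split: if_splits)
  hence t: "0 \<le> t" "t \<le> pi" "cos t \<le> x0" "measure arcsine_law {x0..} = t / pi"
    by (auto simp: t_def measure_arcsine_law_atLeast arccos_lbound arccos_ubound)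
  define \<theta> where "\<theta> = (\<lambda>j::nat. (2 * real j + 1) * pi / (2 * real m))"
  \<comment> \<open>The least \<open>k\<close> with \<open>t \<le> \<theta> k\<close>; conversion by
    \<open>nat\<close> matters when the ceiling would be negative or zero, giving
    \<open>k = 0\<close>.\<close>
  define k where "k = nat \<lceil>real m * t / pi - 1 / 2\<rceil>"
  have k_ge: "real m * t / pi \<le> real k + 1 / 2"
    unfolding k_def by linarith
  have k_le: "real k \<le> real m * t / pi + 1 / 2"
    using t m unfolding k_def by (cases "real m * t / pi - 1 / 2 \<le> 0") (auto, linarith)
  have "real m * (t / pi) < real m * (1 - 2 / real m)"
    using False t m by (intro mult_strict_left_mono) auto
  also have "\<dots> = real m - 2" using m by (simp add: algebra_simps)
  finally have km: "Suc k < m" using k_le by simp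
  have \<theta>_less: "\<theta> i < \<theta> j" if "i < j" for i j
    using that m by (simp add: \<theta>_def divide_strict_right_mono)
  have \<theta>_range: "0 \<le> \<theta> j" "j < m \<Longrightarrow> \<theta> j \<le> pi" for j
  proof -
    show "0 \<le> \<theta> j" by (simp add: \<theta>_def)
    assume "j < m"
    hence "(2 * real j + 1) / (2 * real m) * pi \<le> 1 * pi"
      by (intro mult_right_mono) auto
    thus "\<theta> j \<le> pi" by (simp add: \<theta>_def)
  qed
  have cos_less: "cos (\<theta> j) < cos (\<theta> i)" if "i < j" "j < m" for i j
    using that \<theta>_range \<theta>_less by (intro cos_monotone_0_pi) auto
  have inj: "inj_on (\<lambda>j. cos (\<theta> j)) S" if "S \<subseteq> {..<m}" for S
  proof (rule linorder_inj_onI')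
    fix i j assume "i \<in> S" "j \<in> S" "i < j"
    thus "cos (\<theta> i) \<noteq> cos (\<theta> j)" using cos_less[of i j] that by auto
  qed
  have "t \<le> \<theta> k"
  proof -
    have "t = (real m * t / pi) * (pi / real m)" using m by simp
    also have "\<dots> \<le> (real k + 1 / 2) * (pi / real m)"
      using k_ge by (intro mult_right_mono) auto
    also have "\<dots> = \<theta> k" by (simp add: \<theta>_def add_divide_distrib algebra_simps)
    finally show ?thesis .
  qed
  hence c_le: "cos (\<theta> k) \<le> x0"
    using cos_monotone_0_pi_le[of t "\<theta> k"] t \<theta>_range[of k] km by simp
  \<comment> \<open>Cosine decreases on \<open>{0..pi}\<close>, so larger indices are nodes to the
    left of \<open>cos (\<theta> k)\<close>.\<close>
  define A where "A = (\<lambda>j. cos (\<theta> j)) ` {k<..<m}"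
  define B where "B = (\<lambda>j. cos (\<theta> j)) ` {..<k}"
  have cardAB: "card A + card B = m - 1"
    unfolding A_def B_def using km by (subst (1 2) card_image) (auto intro!: inj)
  have "A \<noteq> {}" using km by (auto simp: A_def)
  then obtain P :: "real poly" where P: "degree P \<le> 2 * (card A + card B)"
      "\<And>a. a \<in> A \<Longrightarrow> poly P a = 0" "\<And>b. b \<in> insert (cos (\<theta> k)) B \<Longrightarrow> poly P b = 1"
      "\<And>x. of_bool (cos (\<theta> k) \<le> x) \<le> poly P x"
    by (rule one_sided_interpolation[of A B "cos (\<theta> k)", rotated 2])
      (use km cos_less in \<open>auto simp: A_def B_def\<close>)
  define d where "d = 2 * (m - 1)"
  obtain a where a: "P = (\<Sum>n\<le>d. smult (a n) (cheb_T n))"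
    using cheb_T_expansion[OF P(1)] unfolding cardAB d_def by blast
  have Pa: "poly P x = (\<Sum>n\<le>d. a n * poly (cheb_T n) x)" for x
    by (simp add: a poly_sum)
  \<comment> \<open>The sum of \<open>P\<close> over all nodes is computed twice: the interpolated
    values give \<open>k + 1\<close>, while discrete orthogonality leaves only
    \<open>a 0 * real m\<close>, because the degree stays below \<open>2 * m\<close>.\<close>
  have "(\<Sum>j<m. poly P (cos (\<theta> j))) = (\<Sum>j<m. of_bool (j \<le> k))"
  proof (intro sum.cong refl)
    fix j assume "j \<in> {..<m}"
    thus "poly P (cos (\<theta> j)) = of_bool (j \<le> k)"
      using P(2)[of "cos (\<theta> j)"] P(3)[of "cos (\<theta> j)"] by (cases j k rule: linorder_cases) (auto simp: A_def B_def)
  qed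
  also have "\<dots> = real (card ({..<m} \<inter> {j. j \<le> k}))"
    by (simp add: sum_of_bool_eq)
  also have "{..<m} \<inter> {j. j \<le> k} = {..k}" using km by auto
  finally have "(\<Sum>j<m. poly P (cos (\<theta> j))) = real k + 1" by simp
  moreover have "(\<Sum>j<m. poly P (cos (\<theta> j))) = (\<Sum>n\<le>d. a n * (\<Sum>j<m. cos (real n * \<theta> j)))"
    unfolding Pa poly_cheb_T_cos sum_distrib_left by (rule sum.swap)
  moreover have "\<dots> = (\<Sum>n\<le>d. if n = 0 then a 0 * real m else 0)"
  proof (intro sum.cong refl)
    fix n assume "n \<in> {..d}"
    thus "a n * (\<Sum>j<m. cos (real n * \<theta> j)) = (if n = 0 then a 0 * real m else 0)"
      using sum_cos_odd_multiples[of n m] m by (auto simp: \<theta>_def d_def)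
  qed
  ultimately have "a 0 * real m = real k + 1" by simp
  hence a0: "a 0 = (real k + 1) / real m" using m by (simp add: field_simps)
  show ?thesis
  proof (rule that[of a])
    fix x
    have "(of_bool (x0 \<le> x) :: real) \<le> of_bool (cos (\<theta> k) \<le> x)" using c_le by auto
    also note P(4)[of x]
    also note Pa[of x]
    finally show "of_bool (x0 \<le> x) \<le> (\<Sum>n\<le>2 * (m - 1). a n * poly (cheb_T n) x)"
      by (simp add: d_def)
  next
    have "a 0 \<le> (real m * t / pi + 2) / real m"
      unfolding a0 using k_le by (intro divide_right_mono) auto
    also have "\<dots> = t / pi + 2 / real m" using m by (simp add: add_divide_distrib)
    finally show "a 0 \<le> measure arcsine_law {x0..} + 2 / real m" using t by simp
  next
    fix n assume n: "0 < n" "n \<le> 2 * (m - 1)"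
    \<comment> \<open>The bound is used at the node angle \<open>\<theta> k\<close> instead of
      \<open>t\<close>, since \<open>P\<close> majorises the indicator from the node on. There the
      excess is \<open>(k + 1) / m - (2 * k + 1) / (2 * m) = 1 / (2 * m)\<close>.\<close>
    have "\<bar>a n\<bar> \<le> 2 * (a 0 - \<theta> k / pi) + 1 / real n"
      using n km \<theta>_range[of k] by (intro cheb_coeff_bound[OF Pa P(4)]) (auto simp: d_def)
    also have "2 * (a 0 - \<theta> k / pi) = 1 / real m"
      using m by (simp add: a0 \<theta>_def field_simps)
    also have "1 / real m \<le> 2 / real n"
    proof -
      have "real n \<le> 2 * real m" using n by simp
      thus ?thesis using n m by (simp add: field_simps)
    qed
    finally show "\<bar>a n\<bar> \<le> 3 / real n" by simp
  qed
qed

section \<open>Integrating the majorant against a measure\<close>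

lemma (in real_distribution) integrable_poly:
  assumes "integrable M (\<lambda>x. \<bar>x\<bar> ^ n)" "degree p \<le> n"
  shows "integrable M (\<lambda>x. poly p x)"
proof -
  have "integrable M (\<lambda>x. x ^ i)" if "i \<le> n" for i
  proof (rule Bochner_Integration.integrable_bound)
    show "integrable M (\<lambda>x. 1 + \<bar>x\<bar> ^ n)" using assms by simp
    have "\<bar>x\<bar> ^ i \<le> 1 + \<bar>x\<bar> ^ n" for x :: real
      using that power_increasing[of i n "\<bar>x\<bar>"] power_le_one[of "\<bar>x\<bar>" i]
      by (cases "1 \<le> \<bar>x\<bar>") (auto simp: add_increasing2)
    thus "AE x in M. norm (x ^ i) \<le> norm (1 + \<bar>x\<bar> ^ n)"
      by (simp add: power_abs)
  qed measurable
  thus ?thesis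
    unfolding poly_altdef using assms(2) by (intro Bochner_Integration.integrable_sum integrable_mult_right) auto
qed

lemma measure_atLeast_upper_bound:
  fixes M :: "real measure"
  assumes "real_distribution M" and N: "0 < N" and int: "integrable M (\<lambda>x. \<bar>x\<bar> ^ N)"
  shows "measure M {x0..} \<le> measure arcsine_law {x0..} +
    4 * (1 / real N + (\<Sum>n=1..N. 1 / real n * \<bar>\<integral>x. poly (cheb_T n) x \<partial>M\<bar>))"
proof -
  interpret real_distribution M by fact
  \<comment> \<open>The largest \<open>m\<close> for which the majorant's degree bound
    \<open>2 * (m - 1)\<close> stays within the available moments; also
    \<open>N \<le> 2 * m\<close>, which turns \<open>2 / real m\<close> into
    \<open>4 / real N\<close>.\<close>
  define m where "m = N div 2 + 1"
  have m: "0 < m" by (simp add: m_def)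
  define d where "d = 2 * (m - 1)"
  have d: "d \<le> N" by (simp add: d_def m_def)
  have Tint: "integrable M (\<lambda>x. poly (cheb_T n) x)" if "n \<le> N" for n
    using integrable_poly[OF int, of "cheb_T n"] that by (simp add: degree_cheb_T)
  let ?E = "\<lambda>n. \<integral>x. poly (cheb_T n) x \<partial>M"
  obtain a where a: "\<And>x. of_bool (x0 \<le> x) \<le> (\<Sum>n\<le>d. a n * poly (cheb_T n) x)"
    "a 0 \<le> measure arcsine_law {x0..} + 2 / real m"
    "\<And>n. 0 < n \<Longrightarrow> n \<le> d \<Longrightarrow> \<bar>a n\<bar> \<le> 3 / real n"
    using cheb_T_majorant[OF m] unfolding d_def by blast
  have "measure M {x0..} = (\<integral>x. indicator {x0..} x \<partial>M)" by simp
  also have "\<dots> \<le> (\<integral>x. (\<Sum>n\<le>d. a n * poly (cheb_T n) x) \<partial>M)"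
  proof (rule integral_mono)
    show "integrable M (indicator {x0..} :: real \<Rightarrow> real)"
      by (intro integrable_real_indicator) (auto simp: emeasure_eq_measure)
    show "integrable M (\<lambda>x. \<Sum>n\<le>d. a n * poly (cheb_T n) x)"
      using d by (intro Bochner_Integration.integrable_sum integrable_mult_right Tint) simp
    show "indicator {x0..} x \<le> (\<Sum>n\<le>d. a n * poly (cheb_T n) x)" for x
      using a(1)[of x] by (simp add: indicator_def of_bool_def)
  qed
  also have "\<dots> = (\<Sum>n\<le>d. a n * ?E n)"
    using d Tint by (subst Bochner_Integration.integral_sum) auto
  also have "\<dots> = a 0 + (\<Sum>n=1..d. a n * ?E n)"
  proof -
    have "poly (cheb_T 0) = (\<lambda>_. 1)" by (auto simp: cheb_T_0)
    thus ?thesis using prob_space by (simp add: atMost_atLeast0 sum.atLeast_Suc_atMost)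
  qed
  \<comment> \<open>The coefficient bound \<open>3 / real n\<close> is relaxed to
    \<open>4 / real n\<close>, so that one constant serves both this sum and the
    \<open>1 / real N\<close> term.\<close>
  also have "(\<Sum>n=1..d. a n * ?E n) \<le> (\<Sum>n=1..d. 4 * (1 / real n * \<bar>?E n\<bar>))"
  proof (rule sum_mono)
    fix n assume n: "n \<in> {1..d}"
    have "a n * ?E n \<le> \<bar>a n\<bar> * \<bar>?E n\<bar>" by (simp flip: abs_mult)
    also have "\<dots> \<le> (4 / real n) * \<bar>?E n\<bar>"
      using n a(3)[of n] by (intro mult_right_mono) (auto elim!: order_trans simp: divide_right_mono)
    finally show "a n * ?E n \<le> 4 * (1 / real n * \<bar>?E n\<bar>)" by simp
  qed
  also have "\<dots> \<le> (\<Sum>n=1..N. 4 * (1 / real n * \<bar>?E n\<bar>))"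
    using d by (intro sum_mono2) auto
  also have "\<dots> = 4 * (\<Sum>n=1..N. 1 / real n * \<bar>?E n\<bar>)"
    by (simp add: sum_distrib_left)
  also note a(2)
  also have "2 / real m \<le> 4 / real N"
  proof -
    have "N \<le> 2 * m" unfolding m_def by presburger
    hence "real N \<le> 2 * real m" by simp
    thus ?thesis using N m by (simp add: field_simps)
  qed
  finally show ?thesis by (simp add: algebra_simps)
qed

section \<open>Reflection and the two-sided bound\<close>

lemma measure_arcsine_law_reflect:
  "measure arcsine_law {-x..} = 1 - measure arcsine_law {x..}"
  by (auto simp: measure_arcsine_law_atLeast arccos_minus diff_divide_distrib)

theorem proposition2:
  shows "\<exists>K::real. K > 0 \<and>
    (\<forall>(n\<^sub>0::nat) (\<mu>::real measure) (x\<^sub>0::real).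
       n\<^sub>0 \<ge> 1 \<longrightarrow> real_distribution \<mu> \<longrightarrow> integrable \<mu> (\<lambda>x. \<bar>x\<bar> ^ n\<^sub>0) \<longrightarrow>
       \<bar>measure \<mu> {x\<^sub>0..} - measure arcsine_law {x\<^sub>0..}\<bar>
         \<le> K * (1 / real n\<^sub>0 + (\<Sum>n=1..n\<^sub>0. 1 / real n * \<bar>\<integral>x. poly (cheb_T n) x \<partial>\<mu>\<bar>)))"
proof (intro exI[of _ 4] conjI allI impI)
  fix N :: nat and \<mu> :: "real measure" and x0 :: real
  assume N: "N \<ge> 1" and "real_distribution \<mu>" and int: "integrable \<mu> (\<lambda>x. \<bar>x\<bar> ^ N)"
  interpret real_distribution \<mu> by fact
  let ?R = "4 * (1 / real N + (\<Sum>n=1..N. 1 / real n * \<bar>\<integral>x. poly (cheb_T n) x \<partial>\<mu>\<bar>))"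
  \<comment> \<open>The upper bound for the reflected measure at \<open>-x0\<close> becomes a lower
    bound for \<open>\<mu>\<close> at \<open>x0\<close>. By parity of \<open>cheb_T n\<close> its
    Chebyshev moments change only in sign, so the right-hand side is the same.\<close>
  define \<nu> where "\<nu> = distr \<mu> borel uminus"
  have "real_distribution \<nu>"
    unfolding \<nu>_def by (rule real_distribution_distr) simp
  moreover have "integrable \<nu> (\<lambda>x. \<bar>x\<bar> ^ N)"
    using int by (simp add: \<nu>_def integrable_distr_eq)
  ultimately have "measure \<nu> {-x0..} \<le> measure arcsine_law {-x0..} +
      4 * (1 / real N + (\<Sum>n=1..N. 1 / real n * \<bar>\<integral>x. poly (cheb_T n) x \<partial>\<nu>\<bar>))"
    using N by (intro measure_atLeast_upper_bound) auto
  also have "(\<integral>x. poly (cheb_T n) x \<partial>\<nu>) = (-1) ^ n * (\<integral>x. poly (cheb_T n) x \<partial>\<mu>)" for n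
  proof -
    have "poly (cheb_T n) \<in> borel_measurable borel"
      by (intro borel_measurable_continuous_onI continuous_intros)
    thus ?thesis
      using integral_distr[of uminus \<mu> borel "poly (cheb_T n)"] by (simp add: \<nu>_def poly_cheb_T_minus)
  qed
  hence "4 * (1 / real N + (\<Sum>n=1..N. 1 / real n * \<bar>\<integral>x. poly (cheb_T n) x \<partial>\<nu>\<bar>)) = ?R"
    by (simp add: abs_mult)
  also have "measure \<nu> {-x0..} = measure \<mu> {..x0}"
    by (simp add: \<nu>_def measure_distr) (auto intro!: arg_cong[of _ _ "measure \<mu>"])
  \<comment> \<open>Reflection yields the open half-line, which is contained in
    \<open>{x0..}\<close>; a possible atom at \<open>x0\<close> therefore only helps the lower
    bound.\<close>
  also have "\<dots> = 1 - measure \<mu> {x0<..}"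
    using prob_compl[of "{x0<..}"] by (simp add: Compl_eq_Diff_UNIV[symmetric] Compl_greaterThan)
  finally have "measure arcsine_law {x0..} - ?R \<le> measure \<mu> {x0<..}"
    by (simp add: measure_arcsine_law_reflect)
  also have "\<dots> \<le> measure \<mu> {x0..}"
    by (intro finite_measure_mono) auto
  finally show "\<bar>measure \<mu> {x0..} - measure arcsine_law {x0..}\<bar> \<le> ?R"
    using measure_atLeast_upper_bound[OF \<open>real_distribution \<mu>\<close> _ int, of x0] N by auto
qed simp

end
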